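(* Let $X$ be a real Hilbert space, let $A$ and $B$ be maximally monotone operators on $X$, and let $T=T_{(A,B)}$ be the Douglas–Rachford splitting operator of $(A,B)$. For $w\in X$ let $Z_w=\{x\in X : 0\in A(x-w)+Bx-w\}$ be the solution set of the $w$-perturbed problem. Then $$\{w\in X : Z_w\neq\varnothing\}=\operatorname{ran}(\operatorname{Id}-T).$$
   Context: Operators on $X$ may be set-valued. The resolvent of a maximally monotone operator $A$ is $J_A=(\operatorname{Id}+A)^{-1}$ (single-valued, defined on all of $X$) and the reflected resolvent is $R_A=2J_A-\operatorname{Id}$. The Douglas–Rachford splitting operator of the ordered pair $(A,B)$ is $T_{(A,B)}=J_AR_B+\operatorname{Id}-J_B\colon X\to X$. Here $Bx-w=\{u-w : u\in Bx\}$ and sums of sets are Minkowski sums. *)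

theory Defs
  imports "HOL-Analysis.Analysis" "HOL-Library.Set_Algebras"
begin

text \<open>
  Set-valued operators on \<open>X\<close> are functions \<open>'a \<Rightarrow> 'a set\<close>; sums of sets are the Minkowski
  sums of \<^theory>\<open>HOL-Library.Set_Algebras\<close>.
\<close>

definition monotone_op :: "('a::real_inner \<Rightarrow> 'a set) \<Rightarrow> bool" where
  "monotone_op A \<longleftrightarrow> (\<forall>x y. \<forall>u\<in>A x. \<forall>v\<in>A y. 0 \<le> (x - y) \<bullet> (u - v))"

text \<open>
  The order \<open>A \<le> C\<close> on set-valued functions is pointwise inclusion, that is, inclusion of graphs.
\<close>

definition maximally_monotone :: "('a::real_inner \<Rightarrow> 'a set) \<Rightarrow> bool" where
  "maximally_monotone A \<longleftrightarrow>
     monotone_op A \<and> (\<forall>C. monotone_op C \<and> A \<le> C \<longrightarrow> C = A)"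

definition inverse_op :: "('a \<Rightarrow> 'b set) \<Rightarrow> 'b \<Rightarrow> 'a set" where
  "inverse_op A u = {x. u \<in> A x}"

text \<open>
  The resolvent is rendered as a point-valued map: the unique element of \<open>(Id + A)\<^sup>-\<^sup>1 x\<close>.
  This set is a singleton for every \<open>x\<close> when \<open>A\<close> is maximally monotone on a real Hilbert space
  (Minty's theorem); for other operators the value may be unspecified.
\<close>

definition resolvent :: "('a::real_inner \<Rightarrow> 'a set) \<Rightarrow> 'a \<Rightarrow> 'a" where
  "resolvent A x = (THE y. y \<in> inverse_op (\<lambda>z. {z} + A z) x)"

definition reflected_resolvent :: "('a::real_inner \<Rightarrow> 'a set) \<Rightarrow> 'a \<Rightarrow> 'a" where
  "reflected_resolvent A x = 2 *\<^sub>R resolvent A x - x"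

definition dr_operator ::
    "('a::real_inner \<Rightarrow> 'a set) \<Rightarrow> ('a \<Rightarrow> 'a set) \<Rightarrow> 'a \<Rightarrow> 'a" where
  "dr_operator A B x = resolvent A (reflected_resolvent B x) + x - resolvent B x"

text \<open>
  The translate \<open>B x - w\<close> is written as an image, since \<open>B x - {w}\<close> would be set difference.
\<close>

definition perturbed_solutions ::
    "('a::real_inner \<Rightarrow> 'a set) \<Rightarrow> ('a \<Rightarrow> 'a set) \<Rightarrow> 'a \<Rightarrow> 'a set" where
  "perturbed_solutions A B w = {x. 0 \<in> A (x - w) + (\<lambda>u. u - w) ` B x}"

end

theory Submission
  imports Defs
begin

text \<open>
  Write \<open>y - T y = J\<^sub>B y - J\<^sub>A (2 J\<^sub>B y - y)\<close>.  If \<open>x = J\<^sub>B y\<close> and \<open>b = y - x \<in> B x\<close>, then the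
  second resolvent is taken at \<open>x - b\<close>, so \<open>y - T y = w\<close> says exactly that
  \<open>x - b \<in> (x - w) + A (x - w)\<close>, that is \<open>w - b \<in> A (x - w)\<close>; together with \<open>b \<in> B x\<close> this is
  \<open>0 \<in> A (x - w) + B x - w\<close>.  Hence \<open>y \<mapsto> J\<^sub>B y\<close> and \<open>(x, b) \<mapsto> x + b\<close> translate between points \<open>y\<close>
  with \<open>y - T y = w\<close> and solutions of the \<open>w\<close>-perturbed problem.

  Recovering \<open>T\<close> from a solution uses only that points of a resolvent are unique, which is
  monotonicity.  Recovering a solution from an arbitrary \<open>y\<close> needs the resolvents to be defined
  everywhere, which is Minty's theorem (\<open>minty\<close>).  It is proved here by minimising
  \<open>F (x, u) + (\<parallel>x\<parallel>\<^sup>2 + \<parallel>u\<parallel>\<^sup>2) / 2\<close> over \<open>X \<times> X\<close>, where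
  \<open>F (x, u) = sup {x \<bullet> b + a \<bullet> u - a \<bullet> b | b \<in> A a}\<close> is the Fitzpatrick function of \<open>A\<close>.  As \<open>F\<close> is convex
  and lower semicontinuous, the objective is strongly convex, so the parallelogram law makes
  minimising sequences Cauchy and completeness yields a minimiser without any
  separation or duality theorem (\<open>strongly_convex_minimiser\<close>).  The first-order condition at the
  minimiser \<open>(x, u)\<close>, tested on the graph of \<open>A\<close>, and the inequality \<open>F (x, u) \<ge> x \<bullet> u\<close> force
  \<open>u = - x\<close> and \<open>- x \<in> A x\<close>.
\<close>

section \<open>Maximality as an equivalence\<close>

text \<open>
  Maximality says that the graph cannot be enlarged by even one point, so membership in it is
  equivalent to being monotonically related to all its points.  In this form maximality is a single
  equivalence, which transfers at once to translates of the operator.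
\<close>

lemma maximally_monotone_iff:
  "maximally_monotone A \<longleftrightarrow>
     (\<forall>x u. u \<in> A x \<longleftrightarrow> (\<forall>y. \<forall>v\<in>A y. 0 \<le> (x - y) \<bullet> (u - v)))" (is "_ \<longleftrightarrow> ?related")
proof
  assume A: "maximally_monotone A"
  have mono: "0 \<le> (x - y) \<bullet> (u - v)" if "u \<in> A x" "v \<in> A y" for x y u v
    using A that by (auto simp: maximally_monotone_def monotone_op_def)
  have "u \<in> A x" if rel: "\<And>y v. v \<in> A y \<Longrightarrow> 0 \<le> (x - y) \<bullet> (u - v)" for x u
  proof -
    define C where "C = A(x := insert u (A x))"
    have "0 \<le> (y - x) \<bullet> (v - u)" if "v \<in> A y" for y v
      using rel[OF that] by (simp add: inner_diff_left inner_diff_right)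
    then have "monotone_op C"
      using rel mono by (auto simp: monotone_op_def C_def)
    moreover have "A \<le> C"
      by (auto simp: C_def le_fun_def)
    ultimately have "C = A"
      using A by (auto simp: maximally_monotone_def)
    then show ?thesis
      by (metis C_def fun_upd_same insertI1)
  qed
  with mono show ?related by blast
next
  assume A: ?related
  have "C = A" if "monotone_op C" "A \<le> C" for C
  proof -
    have "A x \<subseteq> C x" for x
      using that(2) by (simp add: le_fun_def)
    with that(1) have "C x \<subseteq> A x" for x
      unfolding monotone_op_def using A by (meson subset_iff)
    with \<open>\<And>x. A x \<subseteq> C x\<close> show ?thesis
      by (intro ext subset_antisym)
  qed
  moreover have "monotone_op A"
    unfolding monotone_op_def using A by blast
  ultimately show "maximally_monotone A"
    by (auto simp: maximally_monotone_def)
qed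

lemma maximally_monotone_translate:
  assumes "maximally_monotone A"
  shows "maximally_monotone (\<lambda>x. (\<lambda>u. u - z) ` A x)"
proof -
  have mem: "u \<in> (\<lambda>u. u - z) ` A x \<longleftrightarrow> u + z \<in> A x" for u x
    by (metis (no_types, lifting) add_diff_cancel diff_add_cancel image_iff)
  have related: "u + z \<in> A x \<longleftrightarrow> (\<forall>y. \<forall>v\<in>A y. 0 \<le> (x - y) \<bullet> (u - (v - z)))" for u x
    using assms[unfolded maximally_monotone_iff, rule_format, of "u + z" x]
    by (simp only: diff_diff_eq2)
  show ?thesis
    unfolding maximally_monotone_iff by (simp only: mem ball_simps) (use related in blast)
qed

section \<open>Minimisation of strongly convex functions\<close>

text \<open>
  The set \<open>E\<close> plays the role of the epigraph of a convex lower semicontinuous function \<open>F\<close>; arguing with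
  epigraphs spares extended real values.  The conclusion says that the
  minimiser \<open>p\<close> of \<open>F + \<parallel>\<cdot>\<parallel>\<^sup>2 / 2\<close> satisfies \<open>- p \<in> \<partial>F p\<close>.
\<close>

lemma strongly_convex_minimiser:
  fixes E :: "('h::{real_inner, complete_space} \<times> real) set"
  assumes "closed E" and "convex E" and "E \<noteq> {}"
    and bound: "\<And>q s. (q, s) \<in> E \<Longrightarrow> c \<le> s + (q \<bullet> q) / 2"
  obtains p t where "(p, t) \<in> E" and "\<And>q s. (q, s) \<in> E \<Longrightarrow> t - p \<bullet> (q - p) \<le> s"
proof -
  define \<phi> where "\<phi> = (\<lambda>(q :: 'h, s). s + (q \<bullet> q) / 2)"
  define m where "m = Inf (\<phi> ` E)"
  have bdd: "bdd_below (\<phi> ` E)"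
    using bound by (intro bdd_belowI2[of _ c]) (auto simp: \<phi>_def)
  have m_le: "m \<le> \<phi> e" if "e \<in> E" for e
    unfolding m_def using bdd that by (intro cInf_lower) auto
  have "\<exists>e\<in>E. \<phi> e < m + inverse (real (Suc n))" for n
  proof -
    have "Inf (\<phi> ` E) < m + inverse (real (Suc n))"
      unfolding m_def[symmetric] by simp
    then show ?thesis
      using cInf_lessD[of "\<phi> ` E"] \<open>E \<noteq> {}\<close> by blast
  qed
  then obtain e where e: "\<And>n. e n \<in> E" "\<And>n. \<phi> (e n) < m + inverse (real (Suc n))"
    by metis
  define P where "P n = fst (e n)" for n
  define S where "S n = snd (e n)" for n
  have PS: "(P n, S n) \<in> E" "S n + (P n \<bullet> P n) / 2 < m + inverse (real (Suc n))" for n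
    using e[of n] by (auto simp: P_def S_def \<phi>_def case_prod_unfold)
  \<comment> \<open>The midpoint of two almost minimal points lies in \<open>E\<close>, and there the objective drops below the
     average by an eighth of their squared distance.\<close>
  have near: "(norm (P i - P j))\<^sup>2 < 8 * inverse (real (Suc N))" if "N \<le> i" "N \<le> j" for N i j
  proof -
    have "(1/2) *\<^sub>R (P i, S i) + (1/2) *\<^sub>R (P j, S j) \<in> E"
      using \<open>convex E\<close> PS by (intro convexD) auto
    from m_le[OF this]
    have mid: "m \<le> (S i + S j) / 2 + (P i \<bullet> P i + 2 * (P i \<bullet> P j) + P j \<bullet> P j) / 8"
      by (simp add: \<phi>_def inner_add_left inner_add_right inner_commute field_simps)
    have "inverse (real (Suc i)) \<le> inverse (real (Suc N))"
      "inverse (real (Suc j)) \<le> inverse (real (Suc N))"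
      using that by (auto intro!: le_imp_inverse_le)
    moreover have "(norm (P i - P j))\<^sup>2 = P i \<bullet> P i - 2 * (P i \<bullet> P j) + P j \<bullet> P j"
      by (simp add: power2_norm_eq_inner inner_diff_left inner_diff_right inner_commute)
    moreover have "d < 8 * \<epsilon>" if "d = a - 2 * b + c" "m \<le> (s + s') / 2 + (a + 2 * b + c) / 8"
      "s + a / 2 < m + \<delta>" "s' + c / 2 < m + \<delta>'" "\<delta> \<le> \<epsilon>" "\<delta>' \<le> \<epsilon>" for a b c d s s' \<delta> \<delta>' \<epsilon> :: real
      using that by (simp add: field_simps)
    ultimately show ?thesis
      using mid PS(2)[of i] PS(2)[of j] by blast
  qed
  have "Cauchy P"
  proof (rule metric_CauchyI)
    fix r :: real assume "0 < r"
    then obtain N where N: "inverse (real (Suc N)) < r\<^sup>2 / 8"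
      using reals_Archimedean[of "r\<^sup>2 / 8"] by auto
    have "dist (P i) (P j) < r" if "N \<le> i" "N \<le> j" for i j
    proof -
      have "(norm (P i - P j))\<^sup>2 < r\<^sup>2"
        using near[OF that] N by linarith
      then show ?thesis
        using \<open>0 < r\<close> by (simp add: dist_norm power_less_imp_less_base)
    qed
    then show "\<exists>M. \<forall>i\<ge>M. \<forall>j\<ge>M. dist (P i) (P j) < r" by blast
  qed
  then obtain p where p: "P \<longlonglongrightarrow> p"
    using Cauchy_convergent convergent_def by blast
  define t where "t = m - (p \<bullet> p) / 2"
  have inv0: "(\<lambda>n. m + inverse (real (Suc n))) \<longlonglongrightarrow> m + 0"
    by (intro tendsto_intros LIMSEQ_inverse_real_of_nat)
  have "(\<lambda>n. \<phi> (P n, S n)) \<longlonglongrightarrow> m"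
  proof (rule tendsto_sandwich[OF _ _ tendsto_const])
    show "\<forall>\<^sub>F n in sequentially. m \<le> \<phi> (P n, S n)"
      using m_le PS(1) by simp
    show "\<forall>\<^sub>F n in sequentially. \<phi> (P n, S n) \<le> m + inverse (real (Suc n))"
      using PS(2) by (auto simp: \<phi>_def intro!: always_eventually less_imp_le)
    show "(\<lambda>n. m + inverse (real (Suc n))) \<longlonglongrightarrow> m"
      using inv0 by simp
  qed
  then have "(\<lambda>n. \<phi> (P n, S n) - (P n \<bullet> P n) / 2) \<longlonglongrightarrow> t"
    unfolding t_def by (intro tendsto_intros p) auto
  then have "S \<longlonglongrightarrow> t"
    by (simp add: \<phi>_def)
  then have "(\<lambda>n. (P n, S n)) \<longlonglongrightarrow> (p, t)"
    using p by (intro tendsto_Pair)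
  then have pt: "(p, t) \<in> E"
    using closed_sequentially[OF \<open>closed E\<close>, of "\<lambda>n. (P n, S n)"] PS(1) by simp
  have "t - p \<bullet> (q - p) \<le> s" if "(q, s) \<in> E" for q s
  proof -
    define g where "g = (\<lambda>l. (s - t) + p \<bullet> (q - p) + l * ((q - p) \<bullet> (q - p)) / 2)"
    \<comment> \<open>\<open>l * g l\<close> is the increment of the objective from \<open>(p, t)\<close> to the point at parameter \<open>l\<close> of the
       segment towards \<open>(q, s)\<close>.\<close>
    have "0 \<le> g l" if l: "0 < l" "l < 1" for l
    proof -
      have "(1 - l) *\<^sub>R (p, t) + l *\<^sub>R (q, s) \<in> E"
        using \<open>convex E\<close> pt \<open>(q, s) \<in> E\<close> l by (intro convexD) auto
      moreover have "(1 - l) *\<^sub>R p + l *\<^sub>R q = p + l *\<^sub>R (q - p)"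
        by (simp add: algebra_simps)
      ultimately have "(p + l *\<^sub>R (q - p), (1 - l) * t + l * s) \<in> E"
        by simp
      from m_le[OF this] have "0 \<le> l * g l"
        unfolding \<phi>_def t_def g_def
        by (simp only: prod.case inner_add_left inner_add_right inner_scaleR_left
            inner_scaleR_right inner_commute[of "q - p" p] distrib_left)
          (simp add: field_simps)
      then show ?thesis
        using l by (simp add: zero_le_mult_iff)
    qed
    then have "\<forall>\<^sub>F l in at_right 0. 0 \<le> g l"
      using eventually_at_right_real[of 0 1] by (auto elim!: eventually_mono)
    moreover have "(g \<longlongrightarrow> g 0) (at_right 0)"
      unfolding g_def by (intro tendsto_intros) auto
    ultimately have "0 \<le> g 0"
      by (intro tendsto_lowerbound[of g]) auto
    then show ?thesis
      by (simp add: g_def)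
  qed
  with pt show ?thesis
    using that by blast
qed

section \<open>Minty's theorem and resolvents\<close>

text \<open>
  The epigraph of the Fitzpatrick function is an intersection of closed half-spaces, one for each point
  \<open>(a, b)\<close> of the graph.  Besides making the graph nonempty, maximality of \<open>A\<close> bounds the Fitzpatrick function
  below by \<open>x \<bullet> u\<close> and puts the point \<open>(- u, - x)\<close> built from the minimiser \<open>(x, u)\<close> into the graph.
\<close>

lemma minty_at_zero:
  fixes A :: "'a::{real_inner, complete_space} \<Rightarrow> 'a set"
  assumes "maximally_monotone A"
  shows "\<exists>x. - x \<in> A x"
proof -
  have A: "u \<in> A x \<longleftrightarrow> (\<forall>y. \<forall>v\<in>A y. 0 \<le> (x - y) \<bullet> (u - v))" for x u
    using assms unfolding maximally_monotone_iff by blast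
  define H where "H a b = {((x, u), t). x \<bullet> b + a \<bullet> u - a \<bullet> b \<le> t}" for a b :: 'a
  define E where "E = (\<Inter>a. \<Inter>b\<in>A a. H a b)"
  have E_iff: "((x, u), t) \<in> E \<longleftrightarrow> (\<forall>a. \<forall>b\<in>A a. x \<bullet> b + a \<bullet> u - a \<bullet> b \<le> t)" for x u t
    by (simp add: E_def H_def)
  have "closed (H a b)" for a b
    unfolding H_def case_prod_unfold by (intro closed_Collect_le continuous_intros)
  then have "closed E"
    unfolding E_def by (intro closed_INT ballI)
  have "convex (H a b)" for a b
  proof -
    have "H a b = {e. ((b, a), - 1) \<bullet> e \<le> a \<bullet> b}"
      by (auto simp: H_def inner_commute)
    then show ?thesis
      by (simp add: convex_halfspace_le)
  qed
  then have "convex E"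
    unfolding E_def by (intro convex_INT)
  have graph: "((a, b), a \<bullet> b) \<in> E" if "b \<in> A a" for a b
  proof -
    have "0 \<le> (a - y) \<bullet> (b - v)" if "v \<in> A y" for y v
      using A \<open>b \<in> A a\<close> that by blast
    then show ?thesis
      by (auto simp: E_iff inner_diff_left inner_diff_right algebra_simps)
  qed
  have "\<exists>a b. b \<in> A a"
    using A by blast
  then have "E \<noteq> {}"
    using graph by blast
  have fitzpatrick: "x \<bullet> u \<le> t" if E: "((x, u), t) \<in> E" for x u t
  proof (cases "u \<in> A x")
    case True
    then have "x \<bullet> u + x \<bullet> u - x \<bullet> u \<le> t"
      using E unfolding E_iff by blast
    then show ?thesis
      by simp
  next
    case False
    then obtain a b where "b \<in> A a" "(x - a) \<bullet> (u - b) < 0"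
      by (auto simp: A[of u x] not_le)
    moreover have "x \<bullet> b + a \<bullet> u - a \<bullet> b \<le> t"
      using E \<open>b \<in> A a\<close> by (simp add: E_iff)
    ultimately show ?thesis
      by (simp add: inner_diff_left inner_diff_right)
  qed
  have "0 \<le> s + (q \<bullet> q) / 2" if "(q, s) \<in> E" for q s
  proof -
    obtain x u where q: "q = (x, u)"
      by fastforce
    have "0 \<le> (x + u) \<bullet> (x + u) / 2"
      by simp
    also have "\<dots> = x \<bullet> u + (q \<bullet> q) / 2"
      by (simp add: q inner_add_left inner_add_right inner_commute field_simps)
    also have "\<dots> \<le> s + (q \<bullet> q) / 2"
      using fitzpatrick that by (intro add_right_mono) (simp add: q)
    finally show ?thesis .
  qed
  from strongly_convex_minimiser[OF \<open>closed E\<close> \<open>convex E\<close> \<open>E \<noteq> {}\<close> this]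
  obtain p t where "(p, t) \<in> E" and "\<And>q s. (q, s) \<in> E \<Longrightarrow> t - p \<bullet> (q - p) \<le> s"
    by blast
  then obtain x u where xu: "((x, u), t) \<in> E"
    and opt: "\<And>q s. (q, s) \<in> E \<Longrightarrow> t - (x, u) \<bullet> (q - (x, u)) \<le> s"
    by (metis surj_pair)
  \<comment> \<open>On the graph the Fitzpatrick function is at most \<open>a \<bullet> b\<close>, so optimality tested at \<open>(a, b)\<close> is
     \<open>a \<bullet> b \<ge> t + x \<bullet> x + u \<bullet> u - x \<bullet> a - u \<bullet> b\<close>; complete the product and use \<open>t \<ge> x \<bullet> u\<close>.\<close>
  have key: "(x + u) \<bullet> (x + u) \<le> (- u - a) \<bullet> (- x - b)" if "b \<in> A a" for a b
    using opt[OF graph[OF that]] fitzpatrick[OF xu]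
    by (simp add: inner_diff_left inner_diff_right inner_add_left inner_add_right
        inner_commute algebra_simps)
  then have "- x \<in> A (- u)"
    using A inner_ge_zero order_trans by blast
  moreover from key[OF this] have "u = - x"
    by (simp add: add_eq_0_iff flip: power2_norm_eq_inner)
  ultimately show ?thesis
    by auto
qed

theorem minty:
  fixes A :: "'a::{real_inner, complete_space} \<Rightarrow> 'a set"
  assumes "maximally_monotone A"
  shows "\<exists>x. z - x \<in> A x"
proof -
  from minty_at_zero[OF maximally_monotone_translate[OF assms, of z]]
  obtain x u where "- x = u - z" "u \<in> A x"
    by blast
  then have "z - x \<in> A x"
    by (simp add: algebra_simps)
  then show ?thesis ..
qed

lemma resolvent_eqI:
  assumes "monotone_op A" and "z - x \<in> A x"
  shows "resolvent A z = x"
proof -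
  have mem: "y \<in> inverse_op (\<lambda>x. {x} + A x) z \<longleftrightarrow> z - y \<in> A y" for y
    by (auto simp: inverse_op_def set_plus_def intro: bexI[of _ "z - y"])
  have "y = x" if "z - y \<in> A y" for y
  proof -
    have "0 \<le> (y - x) \<bullet> ((z - y) - (z - x))"
      using assms that unfolding monotone_op_def by blast
    also have "\<dots> = - ((y - x) \<bullet> (y - x))"
      by (simp add: inner_diff_left inner_diff_right inner_commute)
    finally show ?thesis
      by (simp flip: power2_norm_eq_inner)
  qed
  then show ?thesis
    unfolding resolvent_def mem using assms(2) by blast
qed

lemma resolvent_mem:
  fixes A :: "'a::{real_inner, complete_space} \<Rightarrow> 'a set"
  assumes "maximally_monotone A"
  shows "z - resolvent A z \<in> A (resolvent A z)"
  using minty[OF assms, of z] resolvent_eqI assms by (metis maximally_monotone_def)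

section \<open>Perturbed solutions and the Douglas--Rachford operator\<close>

lemma perturbed_solutions_iff:
  "x \<in> perturbed_solutions A B w \<longleftrightarrow> (\<exists>b\<in>B x. w - b \<in> A (x - w))"
proof -
  have "a + (b - w) = 0 \<longleftrightarrow> a = w - b" for a b
    by (auto simp: algebra_simps add_eq_0_iff)
  then show ?thesis
    by (auto simp: perturbed_solutions_def set_plus_def eq_commute[of 0])
qed

theorem corollary3p4:
  fixes A B :: "'a::{real_inner, complete_space} \<Rightarrow> 'a set"
  assumes "maximally_monotone A" and "maximally_monotone B"
  shows "{w. perturbed_solutions A B w \<noteq> {}} = range (\<lambda>x. x - dr_operator A B x)"
proof (intro equalityI subsetI)
  have mono: "monotone_op A" "monotone_op B"
    using assms by (simp_all add: maximally_monotone_def)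
  fix w assume "w \<in> {w. perturbed_solutions A B w \<noteq> {}}"
  then obtain x b where b: "b \<in> B x" "w - b \<in> A (x - w)"
    by (auto simp: perturbed_solutions_iff)
  have JB: "resolvent B (x + b) = x"
    using mono b by (intro resolvent_eqI) auto
  have "resolvent A (x - b) = x - w"
    using mono b by (intro resolvent_eqI) auto
  moreover have "reflected_resolvent B (x + b) = x - b"
    by (simp add: reflected_resolvent_def JB scaleR_2)
  ultimately have "(x + b) - dr_operator A B (x + b) = w"
    by (simp add: dr_operator_def JB)
  then show "w \<in> range (\<lambda>x. x - dr_operator A B x)"
    by blast
next
  fix w assume "w \<in> range (\<lambda>x. x - dr_operator A B x)"
  then obtain y where w: "w = y - dr_operator A B y"
    by blast
  define x where "x = resolvent B y"
  define r where "r = reflected_resolvent B y"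
  have "resolvent A r = x - w"
    by (simp add: w dr_operator_def x_def r_def)
  then have "r - (x - w) \<in> A (x - w)"
    using resolvent_mem[OF assms(1), of r] by simp
  moreover have "r - (x - w) = w - (y - x)"
    by (simp add: r_def reflected_resolvent_def x_def scaleR_2)
  moreover have "y - x \<in> B x"
    using resolvent_mem[OF assms(2)] by (simp add: x_def)
  ultimately have "x \<in> perturbed_solutions A B w"
    by (auto simp: perturbed_solutions_iff)
  then show "w \<in> {w. perturbed_solutions A B w \<noteq> {}}"
    by blast
qed

end
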